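(* Let $H=\mathcal{A}+V$ be the Schrödinger operator on the tree $\mathcal{T}$ and let $E\in\mathfrak{S}$. Then for any $v\in\mathcal{T}$ and $\xi\in\partial\mathcal{T}$, the limit $$P_{E,\xi}(v):=\lim_{\eta\downarrow0}P_{E+i\eta,\xi}(v)$$ exists.
   Context: Setting. $\mathcal{T}$ is a tree with uniformly bounded degree; its vertex set is also denoted $\mathcal{T}$, $w\sim v$ means that $v,w$ are nearest neighbors, $d$ is the graph distance. $V:\mathcal{T}\to\mathbb{R}$ is an arbitrary real potential and $H=\mathcal{A}+V$, i.e. $(H\psi)(v)=\sum_{w\sim v}\psi(w)+V(v)\psi(v)$, self-adjoint on $D(H)=\{\psi\in\ell^2(\mathcal{T}):V\psi\in\ell^2(\mathcal{T})\}$. $\langle f,g\rangle=\sum_v\overline{f(v)}g(v)$. Green functions. For $v\sim w$, $\mathcal{T}^{(v|w)}$ is the tree obtained from $\mathcal{T}$ by removing the branch emanating from $v$ that passes through $w$ (the vertex $v$ is kept), and $H^{(v|w)}$ is the restriction of $H$ to it: $H^{(v|w)}(u,u')=H(u,u')$ if $u,u'\in\mathcal{T}^{(v|w)}$ and $0$ otherwise. For $\gamma\in\mathbb{C}\setminus\mathbb{R}$, $G(u,u';\gamma)=\langle\delta_u,(H-\gamma)^{-1}\delta_{u'}\rangle$, $G^{(v|w)}(u,u';\gamma)=\langle\delta_u,(H^{(v|w)}-\gamma)^{-1}\delta_{u'}\rangle$, and $\zeta_w^\gamma(v)=-G^{(v|w)}(v,v;\gamma)$. Let $\mathfrak{A}\subset\mathbb{R}$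 be a Lebesgue-null set such that for all $E\in\mathfrak{S}:=\mathbb{R}\setminus\mathfrak{A}$, all $v\in\mathcal{T}$ and $w\sim v$, the limits $\lim_{\eta\downarrow0}G(v,v;E+i\eta)$ and $\lim_{\eta\downarrow0}\zeta_w^{E+i\eta}(v)$ exist, are finite and non-zero (such a set exists). Boundary. An arc is a finite non-backtracking path; $[v,w]$ is the unique arc from $v$ to $w$. A chain is an infinite non-backtracking path; chains $(u_0,u_1,\dots)$ and $(v_0,v_1,\dots)$ are equivalent if $u_k=v_{k+n}$ for some $n\in\mathbb{Z}$ and all $k$. The geometric boundary $\partial\mathcal{T}$ is the set of equivalence classes of chains; each class $\xi$ has a representative $[v,\xi]$ starting at any given $v\in\mathcal{T}$. Fix an origin $o\in\mathcal{T}$ and put $|v|=d(v,o)$. For $v\in\mathcal{T}$, $\xi\in\partial\mathcal{T}$, $v\wedge\xi$ is the vertex of maximal length $|\cdot|$ in $[o,v]\cap[o,\xi]$. Poisson kernel. For $\gamma\in\mathbb{C}$ with $\operatorname{Im}\gamma>0$ and $\xi\in\partial\mathcal{T}$, $P_{\gamma,\xi}(v)=\dfrac{G(v\wedge\xi,v;\gamma)}{G(o,v\wedge\xi;\gamma)}$. *)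

theory Defs
  imports "HOL-Analysis.Analysis"
begin

section \<open>Trees\<close>

text \<open>A graph is given by its nearest-neighbour relation; the vertex set is the whole type
  \<open>'a\<close>.\<close>

definition simple_graph :: "('a \<Rightarrow> 'a \<Rightarrow> bool) \<Rightarrow> bool" where
  "simple_graph adj \<longleftrightarrow> (\<forall>v w. adj v w \<longrightarrow> adj w v) \<and> (\<forall>v. \<not> adj v v)"

definition connected_graph :: "('a \<Rightarrow> 'a \<Rightarrow> bool) \<Rightarrow> bool" where
  "connected_graph adj \<longleftrightarrow> (\<forall>v w. rtranclp adj v w)"

definition cycle :: "('a \<Rightarrow> 'a \<Rightarrow> bool) \<Rightarrow> 'a list \<Rightarrow> bool" where
  "cycle adj p \<longleftrightarrow> 3 \<le> length p \<and> distinct p \<and> successively adj p \<and> adj (last p) (hd p)"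

definition tree :: "('a \<Rightarrow> 'a \<Rightarrow> bool) \<Rightarrow> bool" where
  "tree adj \<longleftrightarrow> simple_graph adj \<and> connected_graph adj \<and> (\<nexists>p. cycle adj p)"

definition bounded_degree :: "('a \<Rightarrow> 'a \<Rightarrow> bool) \<Rightarrow> bool" where
  "bounded_degree adj \<longleftrightarrow> (\<exists>K::nat. \<forall>v. finite {w. adj v w} \<and> card {w. adj v w} \<le> K)"

definition graph_dist :: "('a \<Rightarrow> 'a \<Rightarrow> bool) \<Rightarrow> 'a \<Rightarrow> 'a \<Rightarrow> nat" where
  "graph_dist adj v w = (LEAST n. (adj ^^ n) v w)"

definition is_arc :: "('a \<Rightarrow> 'a \<Rightarrow> bool) \<Rightarrow> 'a list \<Rightarrow> bool" where
  "is_arc adj p \<longleftrightarrow> p \<noteq> [] \<and> successively adj p \<and> (\<forall>k. k + 2 < length p \<longrightarrow> p ! (k + 2) \<noteq> p ! k)"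

text \<open>The arc \<open>[v, w]\<close>; in a tree it exists and is unique.\<close>

definition arc_between :: "('a \<Rightarrow> 'a \<Rightarrow> bool) \<Rightarrow> 'a \<Rightarrow> 'a \<Rightarrow> 'a list" where
  "arc_between adj v w = (THE p. is_arc adj p \<and> hd p = v \<and> last p = w)"

text \<open>The vertex set of the tree \<open>T\<^sup>(\<^sup>v\<^sup>|\<^sup>w\<^sup>)\<close>: the branch at \<open>v\<close> through \<open>w\<close> consists of the
  vertices whose arc from \<open>v\<close> passes through \<open>w\<close>.\<close>

definition cut_tree :: "('a \<Rightarrow> 'a \<Rightarrow> bool) \<Rightarrow> 'a \<Rightarrow> 'a \<Rightarrow> 'a set" where
  "cut_tree adj v w = - {u. w \<in> set (arc_between adj v u)}"


section \<open>Geometric boundary\<close>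

definition chains :: "('a \<Rightarrow> 'a \<Rightarrow> bool) \<Rightarrow> (nat \<Rightarrow> 'a) set" where
  "chains adj = {c. \<forall>k. adj (c k) (c (Suc k)) \<and> c (k + 2) \<noteq> c k}"

text \<open>Two chains are equivalent if they agree up to an integer shift of the index. The equality
  is required for all large \<open>k\<close> only: demanding it for every \<open>k\<close> for which both sides are defined
  would make one chain a tail of the other, and that relation is not transitive.\<close>

definition chain_equiv :: "('a \<Rightarrow> 'a \<Rightarrow> bool) \<Rightarrow> ((nat \<Rightarrow> 'a) \<times> (nat \<Rightarrow> 'a)) set" where
  "chain_equiv adj = {(c, c'). c \<in> chains adj \<and> c' \<in> chains adj \<and>
     (\<exists>n::int. \<forall>\<^sub>F k in sequentially. 0 \<le> int k + n \<and> c k = c' (nat (int k + n)))}"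

definition boundary :: "('a \<Rightarrow> 'a \<Rightarrow> bool) \<Rightarrow> (nat \<Rightarrow> 'a) set set" where
  "boundary adj = chains adj // chain_equiv adj"

text \<open>The representative \<open>[v, \<xi>]\<close> of \<open>\<xi>\<close> starting at \<open>v\<close>; in a tree it exists and is unique.\<close>

definition ray :: "'a \<Rightarrow> (nat \<Rightarrow> 'a) set \<Rightarrow> nat \<Rightarrow> 'a" where
  "ray v \<xi> = (THE c. c \<in> \<xi> \<and> c 0 = v)"

text \<open>The vertex \<open>v \<and> \<xi>\<close> relative to the origin \<open>orig\<close>.\<close>

definition meet_bdry :: "('a \<Rightarrow> 'a \<Rightarrow> bool) \<Rightarrow> 'a \<Rightarrow> 'a \<Rightarrow> (nat \<Rightarrow> 'a) set \<Rightarrow> 'a" where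
  "meet_bdry adj orig v \<xi> = arg_max (\<lambda>u. graph_dist adj u orig)
     (\<lambda>u. u \<in> set (arc_between adj orig v) \<inter> range (ray orig \<xi>))"


section \<open>Schroedinger operators and Green functions\<close>

definition ell2 :: "('a \<Rightarrow> complex) set" where
  "ell2 = {\<psi>. (\<lambda>v. (cmod (\<psi> v))\<^sup>2) summable_on UNIV}"

definition ell2_inner :: "('a \<Rightarrow> complex) \<Rightarrow> ('a \<Rightarrow> complex) \<Rightarrow> complex" where
  "ell2_inner f g = (\<Sum>\<^sub>\<infinity>v. cnj (f v) * g v)"

definition delta :: "'a \<Rightarrow> 'a \<Rightarrow> complex" where
  "delta u v = (if v = u then 1 else 0)"

definition schroedinger ::
    "('a \<Rightarrow> 'a \<Rightarrow> bool) \<Rightarrow> ('a \<Rightarrow> real) \<Rightarrow> ('a \<Rightarrow> complex) \<Rightarrow> 'a \<Rightarrow> complex" where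
  "schroedinger adj V \<psi> v = (\<Sum>w | adj v w. \<psi> w) + of_real (V v) * \<psi> v"

definition schroedinger_dom :: "('a \<Rightarrow> real) \<Rightarrow> ('a \<Rightarrow> complex) set" where
  "schroedinger_dom V = {\<psi> \<in> ell2. (\<lambda>v. of_real (V v) * \<psi> v) \<in> ell2}"

definition schroedinger_kernel ::
    "('a \<Rightarrow> 'a \<Rightarrow> bool) \<Rightarrow> ('a \<Rightarrow> real) \<Rightarrow> 'a \<Rightarrow> 'a \<Rightarrow> complex" where
  "schroedinger_kernel adj V u u' = ell2_inner (delta u) (schroedinger adj V (delta u'))"

definition cut_kernel ::
    "('a \<Rightarrow> 'a \<Rightarrow> bool) \<Rightarrow> ('a \<Rightarrow> real) \<Rightarrow> 'a \<Rightarrow> 'a \<Rightarrow> 'a \<Rightarrow> 'a \<Rightarrow> complex" where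
  "cut_kernel adj V v w u u' =
     (if u \<in> cut_tree adj v w \<and> u' \<in> cut_tree adj v w then schroedinger_kernel adj V u u' else 0)"

text \<open>The operator \<open>H\<^sup>(\<^sup>v\<^sup>|\<^sup>w\<^sup>)\<close> with kernel \<open>cut_kernel\<close> acts on the whole of \<open>ell2\<close>, by zero off
  \<open>cut_tree adj v w\<close>; its domain is that of its potential, \<open>V\<close> restricted to the cut tree. For
  graphs of bounded degree the sum has finitely many nonzero terms.\<close>

definition cut_schroedinger ::
    "('a \<Rightarrow> 'a \<Rightarrow> bool) \<Rightarrow> ('a \<Rightarrow> real) \<Rightarrow> 'a \<Rightarrow> 'a \<Rightarrow> ('a \<Rightarrow> complex) \<Rightarrow> 'a \<Rightarrow> complex" where
  "cut_schroedinger adj V v w \<psi> u = (\<Sum>\<^sub>\<infinity>u'. cut_kernel adj V v w u u' * \<psi> u')"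

definition cut_schroedinger_dom ::
    "('a \<Rightarrow> 'a \<Rightarrow> bool) \<Rightarrow> ('a \<Rightarrow> real) \<Rightarrow> 'a \<Rightarrow> 'a \<Rightarrow> ('a \<Rightarrow> complex) set" where
  "cut_schroedinger_dom adj V v w =
     {\<psi> \<in> ell2. (\<lambda>u. if u \<in> cut_tree adj v w then of_real (V u) * \<psi> u else 0) \<in> ell2}"

text \<open>The resolvent \<open>(K - \<gamma>)\<^sup>-\<^sup>1\<close> of an operator \<open>K\<close> with domain \<open>D\<close>. If \<open>K\<close> is self-adjoint and
  \<open>\<gamma>\<close> is not real, then \<open>K - \<gamma>\<close> maps \<open>D\<close> bijectively onto \<open>ell2\<close>.\<close>

definition resolvent ::
    "('a \<Rightarrow> complex) set \<Rightarrow> (('a \<Rightarrow> complex) \<Rightarrow> 'a \<Rightarrow> complex) \<Rightarrow> complex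
      \<Rightarrow> ('a \<Rightarrow> complex) \<Rightarrow> 'a \<Rightarrow> complex" where
  "resolvent D K \<gamma> = inv_into D (\<lambda>\<psi> v. K \<psi> v - \<gamma> * \<psi> v)"

definition green ::
    "('a \<Rightarrow> 'a \<Rightarrow> bool) \<Rightarrow> ('a \<Rightarrow> real) \<Rightarrow> 'a \<Rightarrow> 'a \<Rightarrow> complex \<Rightarrow> complex" where
  "green adj V u u' \<gamma> =
     ell2_inner (delta u) (resolvent (schroedinger_dom V) (schroedinger adj V) \<gamma> (delta u'))"

definition cut_green ::
    "('a \<Rightarrow> 'a \<Rightarrow> bool) \<Rightarrow> ('a \<Rightarrow> real) \<Rightarrow> 'a \<Rightarrow> 'a \<Rightarrow> 'a \<Rightarrow> 'a \<Rightarrow> complex \<Rightarrow> complex" where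
  "cut_green adj V v w u u' \<gamma> =
     ell2_inner (delta u)
       (resolvent (cut_schroedinger_dom adj V v w) (cut_schroedinger adj V v w) \<gamma> (delta u'))"

text \<open>\<open>zeta adj V w \<gamma> v\<close> is \<open>\<zeta>\<^sub>w\<^sup>\<gamma>(v)\<close>, for neighbours \<open>v\<close>, \<open>w\<close>.\<close>

definition zeta ::
    "('a \<Rightarrow> 'a \<Rightarrow> bool) \<Rightarrow> ('a \<Rightarrow> real) \<Rightarrow> 'a \<Rightarrow> complex \<Rightarrow> 'a \<Rightarrow> complex" where
  "zeta adj V w \<gamma> v = - cut_green adj V v w v v \<gamma>"

text \<open>The admissible choices of the exceptional null set \<open>\<AA>\<close>, whose complement is \<open>\<SS>\<close>.\<close>

definition exceptional_set ::
    "('a \<Rightarrow> 'a \<Rightarrow> bool) \<Rightarrow> ('a \<Rightarrow> real) \<Rightarrow> real set \<Rightarrow> bool" where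
  "exceptional_set adj V A \<longleftrightarrow> A \<in> null_sets lebesgue \<and>
     (\<forall>E \<in> - A.
        (\<forall>v. \<exists>L. L \<noteq> 0 \<and>
           ((\<lambda>\<eta>. green adj V v v (of_real E + \<i> * of_real \<eta>)) \<longlongrightarrow> L) (at_right (0::real))) \<and>
        (\<forall>v w. adj w v \<longrightarrow> (\<exists>L. L \<noteq> 0 \<and>
           ((\<lambda>\<eta>. zeta adj V w (of_real E + \<i> * of_real \<eta>) v) \<longlongrightarrow> L) (at_right (0::real)))))"

definition poisson ::
    "('a \<Rightarrow> 'a \<Rightarrow> bool) \<Rightarrow> ('a \<Rightarrow> real) \<Rightarrow> 'a \<Rightarrow> complex \<Rightarrow> (nat \<Rightarrow> 'a) set \<Rightarrow> 'a \<Rightarrow> complex" where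
  "poisson adj V orig \<gamma> \<xi> v =
     green adj V (meet_bdry adj orig v \<xi>) v \<gamma> / green adj V orig (meet_bdry adj orig v \<xi>) \<gamma>"

end

theory Submission
  imports Defs
begin

text \<open>Write \<open>G(u, v)\<close> for \<open>green adj V u v \<gamma>\<close>. The Green function of a tree factorizes along arcs:
  if \<open>w\<close> is the vertex that follows \<open>u\<close> on the arc from \<open>u\<close> to \<open>v\<close>, then
  \<open>G(u, v) = G(w, v) \<zeta>\<^sub>w(u)\<close> (\<open>green_factorization\<close>). By induction along the arc, \<open>G(u, v)\<close> is
  \<open>G(v, v)\<close> times a finite product of values of \<open>\<zeta>\<close>. For \<open>\<gamma> = E + \<i>\<eta>\<close> with \<open>E\<close> outside the
  exceptional set, each of these factors has a finite nonzero limit as \<open>\<eta>\<close> decreases to \<open>0\<close>, hence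
  so has \<open>G(u, v)\<close> for all \<open>u\<close> and \<open>v\<close> (\<open>green_limit_nonzero\<close>). The Poisson kernel is a quotient of
  two such Green functions at vertices which do not depend on \<open>\<eta>\<close>, so it converges.

  The factorization comes from restricting \<open>\<phi> = (H - \<gamma>)\<^sup>-\<^sup>1 \<delta>\<^sub>v\<close> to \<open>cut_tree adj u w\<close>, which contains
  \<open>u\<close> but neither \<open>v\<close> nor \<open>w\<close>. The only edge that leaves the cut tree is the one from \<open>u\<close> to \<open>w\<close>
  (\<open>cut_tree_exit\<close>), so the restriction solves \<open>(H\<^sup>(\<^sup>u\<^sup>|\<^sup>w\<^sup>) - \<gamma>) \<psi> = - \<phi>(w) \<delta>\<^sub>u\<close>. Uniqueness of the
  solution makes it a multiple of \<open>(H\<^sup>(\<^sup>u\<^sup>|\<^sup>w\<^sup>) - \<gamma>)\<^sup>-\<^sup>1 \<delta>\<^sub>u\<close>, and evaluation at \<open>u\<close> gives the formula.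

  This argument needs \<open>H - \<gamma>\<close> and \<open>H\<^sup>(\<^sup>u\<^sup>|\<^sup>w\<^sup>) - \<gamma>\<close> to be bijections from their domains onto \<open>ell2\<close> for
  every \<open>\<gamma>\<close> off the real axis, that is, self-adjointness. Both operators have the form
  \<open>schroedinger R V\<close> with a symmetric relation \<open>R\<close> of bounded degree, so one proof serves both.
  Uniqueness (\<open>schroedinger_equation_unique\<close>) holds because the quadratic form is real. For existence
  (\<open>schroedinger_equation_solvable\<close>) the equation is solved on finite vertex sets, where the
  solutions are bounded uniformly by \<open>\<parallel>f\<parallel> / \<bar>Im \<gamma>\<bar>\<close>, and compactness of a product of discs yields a
  solution on the whole graph.\<close>

section \<open>Arcs in a tree\<close>

lemma is_arc_simps [simp]:
  "\<not> is_arc adj []"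
  "is_arc adj [x]"
  "is_arc adj [x, y] \<longleftrightarrow> adj x y"
  "is_arc adj (x # y # z # r) \<longleftrightarrow> adj x y \<and> x \<noteq> z \<and> is_arc adj (y # z # r)"
proof -
  show "is_arc adj (x # y # z # r) \<longleftrightarrow> adj x y \<and> x \<noteq> z \<and> is_arc adj (y # z # r)"
    unfolding is_arc_def
    by (auto simp: less_Suc_eq_0_disj nth_Cons' split: if_splits)
qed (auto simp: is_arc_def)

lemma is_arc_tl: "is_arc adj (x # y # r) \<Longrightarrow> is_arc adj (y # r)"
  by (cases r) auto

text \<open>Backtracking concerns three consecutive vertices only, so two arcs that overlap in
  an edge fit together to one arc.\<close>

lemma is_arc_glue:
  "is_arc adj (p @ [x, y]) \<Longrightarrow> is_arc adj (x # y # q) \<Longrightarrow> is_arc adj (p @ x # y # q)"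
proof (induction p)
  case (Cons a p)
  then show ?case by (cases p; cases "tl p") (auto split: list.splits)
qed auto

lemma is_arc_appendD1: "is_arc adj (p @ q) \<Longrightarrow> p \<noteq> [] \<Longrightarrow> is_arc adj p"
  unfolding is_arc_def by (auto simp: successively_append_iff nth_append split: if_splits)

lemma is_arc_rev:
  assumes "simple_graph adj" "is_arc adj p"
  shows "is_arc adj (rev p)"
  using assms(2)
proof (induction p rule: induct_list012)
  case (3 x y zs)
  have "adj y x" using 3 assms(1) by (cases zs) (auto simp: simple_graph_def)
  show ?case
  proof (cases zs)
    case Nil
    then show ?thesis using \<open>adj y x\<close> by simp
  next
    case (Cons z r)
    have "is_arc adj (rev (y # z # r))" using 3 Cons by auto
    moreover have "adj z y" using 3(3) Cons assms(1) by (cases r) (auto simp: simple_graph_def)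
    ultimately show ?thesis using is_arc_glue[of adj "rev r" z y "[x]"] 3(3) Cons \<open>adj y x\<close>
      by auto
  qed
qed auto

text \<open>A walk without backtracking that returns to a vertex closes up a cycle. By induction on
  the length only the first vertex can recur, and the cycle then starts there.\<close>

lemma arc_distinct:
  assumes "tree adj" "is_arc adj p"
  shows "distinct p"
  using assms(2)
proof (induction "length p" arbitrary: p rule: less_induct)
  case less
  show ?case
  proof (cases p)
    case (Cons x q)
    show ?thesis
    proof (cases "q = []")
      case False
      have arcq: "is_arc adj q" using less(2) Cons False by (cases q) (auto dest: is_arc_tl)
      have dq: "distinct q" using less(1)[of q] arcq Cons by auto
      have "x \<notin> set q"
      proof
        assume "x \<in> set q"
        then obtain a b where q: "q = a @ x # b" by (auto simp: in_set_conv_decomp)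
        have arc1: "is_arc adj (x # a @ [x])"
          using is_arc_appendD1[of adj "x # a @ [x]" b] less(2) Cons q by simp
        then have "successively adj (x # a @ [x])" by (simp add: is_arc_def)
        then have suc: "successively adj (x # a)" "adj (last (x # a)) x"
          using successively_append_iff[of adj "x # a" "[x]"] by auto
        have "\<not> adj x x" using assms(1) by (auto simp: tree_def simple_graph_def)
        \<comment> \<open>No loops rules out length \<open>0\<close>, no backtracking rules out length \<open>1\<close>.\<close>
        then have "2 \<le> length a" using arc1
          by (cases a; cases "tl a") auto
        then have "cycle adj (x # a)" using suc dq q by (auto simp: cycle_def)
        then show False using assms(1) by (auto simp: tree_def)
      qed
      then show ?thesis using dq Cons by simp
    qed (use Cons in auto)
  qed simp
qed

text \<open>Where two arcs from the same vertex part, running back along one and then forward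
  along the other is again free of backtracking. A common end point would be visited twice on this
  arc, against \<open>arc_distinct\<close>.\<close>

lemma arc_unique:
  assumes T: "tree adj" and "is_arc adj p" "is_arc adj q" "hd p = hd q" "last p = last q"
  shows "p = q"
  using assms(2-)
proof (induction p arbitrary: q)
  case (Cons x p)
  from Cons.prems obtain q' where q: "q = x # q'" by (cases q) auto
  have d: "distinct (x # p)" "distinct (x # q')"
    using arc_distinct[OF T] Cons.prems q by blast+
  show ?case
  proof (cases p)
    case Nil
    then show ?thesis using d(2) Cons.prems(4) q last_in_set[of q'] by (auto split: if_splits)
  next
    case p: (Cons y p')
    show ?thesis
    proof (cases q')
      case Nil
      then show ?thesis using d(1) Cons.prems(4) q p last_in_set[of p'] by (auto split: if_splits)
    next
      case q': (Cons z q'')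
      show ?thesis
      proof (cases "y = z")
        case True
        then show ?thesis using Cons.IH[of q'] Cons.prems p q q' is_arc_tl by fastforce
      next
        case False
        have "is_arc adj (rev q)"
          using is_arc_rev Cons.prems(2) T by (auto simp: tree_def)
        then have "is_arc adj (rev q'' @ [z, x])" using q q' by simp
        moreover have "is_arc adj (z # x # y # p')"
          using Cons.prems q p q' False T by (cases q'') (auto simp: tree_def simple_graph_def)
        ultimately have "is_arc adj (rev q'' @ z # x # y # p')" by (rule is_arc_glue)
        then have "distinct (rev q'' @ z # x # y # p')" by (rule arc_distinct[OF T])
        moreover have "last (y # p') = last (z # q'')" using Cons.prems p q q' by simp
        then have "last (y # p') \<in> set (rev q'' @ [z])"
          by (metis last_in_set list.distinct(1) rev.simps(2) set_rev)
        moreover have "last (y # p') \<in> set (y # p')" by (rule last_in_set) simp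
        ultimately show ?thesis by auto
      qed
    qed
  qed
qed simp

lemma arc_exists:
  assumes "tree adj"
  shows "\<exists>p. is_arc adj p \<and> hd p = u \<and> last p = v"
proof -
  have "rtranclp adj u v" using assms by (auto simp: tree_def connected_graph_def)
  then show ?thesis
  proof (induction rule: converse_rtranclp_induct)
    case base
    show ?case by (rule exI[of _ "[v]"]) simp
  next
    case (step x y)
    then obtain p where p: "is_arc adj p" "hd p = y" "last p = v" by blast
    then obtain r where r: "p = y # r" by (cases p) auto
    show ?case
    proof (cases "r \<noteq> [] \<and> hd r = x")
      case True
      then show ?thesis using p r by (intro exI[of _ r]) (cases r, auto dest: is_arc_tl)
    next
      case False
      then show ?thesis using p r step(1) by (intro exI[of _ "x # p"]) (cases r, auto)
    qed
  qed
qed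

lemma arc_between_eqI:
  assumes "tree adj" "is_arc adj p" "hd p = u" "last p = v"
  shows "arc_between adj u v = p"
  unfolding arc_between_def using assms by (intro the_equality) (auto intro: arc_unique)

lemma arc_between_props:
  assumes "tree adj"
  shows "is_arc adj (arc_between adj u v)" "hd (arc_between adj u v) = u"
    "last (arc_between adj u v) = v"
  using arc_exists[OF assms, of u v] arc_between_eqI[OF assms] by auto

lemma arc_between_adj:
  assumes "tree adj" "adj x y"
  shows "set (arc_between adj u y) \<subseteq> insert y (set (arc_between adj u x))"
proof -
  define p where "p = rev (arc_between adj u x)"
  have S: "simple_graph adj" using assms by (simp add: tree_def)
  have p: "is_arc adj p" "hd p = x" "last p = u"
    using arc_between_props[OF assms(1), of u x] is_arc_rev[OF S]
    by (auto simp: p_def hd_rev last_rev)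
  then obtain r where r: "p = x # r" by (cases p) auto
  \<comment> \<open>Backwards from \<open>x\<close>: the step to \<open>y\<close> either retraces the last edge of the arc or extends it.\<close>
  have "\<exists>q. is_arc adj q \<and> hd q = y \<and> last q = u \<and> set q \<subseteq> insert y (set p)"
  proof (cases "r \<noteq> [] \<and> hd r = y")
    case True
    then show ?thesis using p r by (intro exI[of _ r]) (cases r, auto dest: is_arc_tl)
  next
    case False
    moreover have "adj y x" using assms(2) S by (auto simp: simple_graph_def)
    ultimately show ?thesis using p r by (intro exI[of _ "y # p"]) (cases r, auto)
  qed
  then obtain q where q: "is_arc adj q" "hd q = y" "last q = u" "set q \<subseteq> insert y (set p)"
    by blast
  then have "q \<noteq> []" by (cases q) auto
  have "arc_between adj u y = rev q"
    using arc_between_eqI[OF assms(1) is_arc_rev[OF S q(1)]] q \<open>q \<noteq> []\<close>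
    by (auto simp: hd_rev last_rev)
  then show ?thesis using q by (auto simp: p_def)
qed

lemma cut_tree_root:
  assumes "tree adj" "adj v w"
  shows "v \<in> cut_tree adj v w" "w \<notin> cut_tree adj v w"
proof -
  have "v \<noteq> w" using assms by (auto simp: tree_def simple_graph_def)
  moreover have "arc_between adj v v = [v]" "arc_between adj v w = [v, w]"
    using assms by (auto intro: arc_between_eqI)
  ultimately show "v \<in> cut_tree adj v w" "w \<notin> cut_tree adj v w"
    by (auto simp: cut_tree_def)
qed

text \<open>If the neighbour \<open>y\<close> of \<open>x\<close> lies in the branch through \<open>w\<close> although \<open>x\<close> does not, then
  \<open>y\<close> is \<open>w\<close> itself. For \<open>x\<close> other than \<open>v\<close>, the path from \<open>w\<close> to \<open>v\<close> and on to \<open>x\<close> would then be a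
  second arc from \<open>w\<close> to \<open>x\<close>, besides the edge between them.\<close>

lemma cut_tree_exit:
  assumes T: "tree adj" and vw: "adj v w"
    and x: "x \<in> cut_tree adj v w" "adj x y" "y \<notin> cut_tree adj v w"
  shows "x = v \<and> y = w"
proof -
  have S: "simple_graph adj" using assms by (simp add: tree_def)
  have y: "y = w" using arc_between_adj[OF T x(2), of v] x by (auto simp: cut_tree_def)
  have "x = v"
  proof (rule ccontr)
    assume "x \<noteq> v"
    define p where "p = arc_between adj v x"
    have p: "is_arc adj p" "hd p = v" "last p = x" "w \<notin> set p"
      using arc_between_props[OF T, of v x] x by (auto simp: p_def cut_tree_def)
    define q where "q = w # p"
    have "is_arc adj q"
      using p vw S unfolding q_def
      by (cases p; cases "tl p") (auto simp: simple_graph_def)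
    moreover have "is_arc adj [w, x]" using x(2) y S by (auto simp: simple_graph_def)
    ultimately have "q = [w, x]"
      using p by (intro arc_unique[OF T]) (auto simp: q_def)
    then show False using p \<open>x \<noteq> v\<close> by (auto simp: q_def)
  qed
  with y show ?thesis by simp
qed

section \<open>Square-summable functions\<close>

lemma ell2_inner_delta: "ell2_inner (delta u) f = f u"
proof -
  have "ell2_inner (delta u) f = (\<Sum>\<^sub>\<infinity>v\<in>{u}. f v)"
    unfolding ell2_inner_def by (rule infsum_cong_neutral) (auto simp: delta_def)
  then show ?thesis by simp
qed

lemma green_eq: "green adj V u v \<gamma> =
    resolvent (schroedinger_dom V) (schroedinger adj V) \<gamma> (delta v) u"
  by (simp add: green_def ell2_inner_delta)

lemma schroedinger_kernel_eq:
  assumes "bounded_degree adj"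
  shows "schroedinger_kernel adj V u u' =
    (if adj u u' then 1 else 0) + (if u = u' then of_real (V u) else 0)"
  using assms by (auto simp: bounded_degree_def schroedinger_kernel_def ell2_inner_delta
      schroedinger_def delta_def sum.delta)

lemma ell2_comparison:
  assumes "f \<in> ell2" "\<And>v. cmod (g v) \<le> cmod (f v)"
  shows "g \<in> ell2"
  unfolding ell2_def mem_Collect_eq
  by (rule summable_on_comparison_test[of "\<lambda>v. (cmod (f v))\<^sup>2"])
     (use assms in \<open>auto simp: ell2_def intro: power_mono\<close>)

lemma ell2_add:
  assumes "f \<in> ell2" "g \<in> ell2"
  shows "(\<lambda>v. f v + g v) \<in> ell2"
  unfolding ell2_def mem_Collect_eq
proof (rule summable_on_comparison_test)
  show "(\<lambda>v. 2 * (cmod (f v))\<^sup>2 + 2 * (cmod (g v))\<^sup>2) summable_on UNIV"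
    using assms by (intro summable_on_add summable_on_cmult_right) (auto simp: ell2_def)
  show "(cmod (f v + g v))\<^sup>2 \<le> 2 * (cmod (f v))\<^sup>2 + 2 * (cmod (g v))\<^sup>2" for v
  proof -
    have "(cmod (f v + g v))\<^sup>2 \<le> (cmod (f v) + cmod (g v))\<^sup>2"
      by (intro power_mono norm_triangle_ineq) auto
    also have "\<dots> \<le> 2 * (cmod (f v))\<^sup>2 + 2 * (cmod (g v))\<^sup>2"
      using sum_squares_bound[of "cmod (f v)" "cmod (g v)"] by (simp add: power2_sum)
    finally show ?thesis .
  qed
qed auto

lemma ell2_scale:
  assumes "f \<in> ell2"
  shows "(\<lambda>v. c * f v) \<in> ell2"
  using assms summable_on_cmult_right[of "\<lambda>v. (cmod (f v))\<^sup>2" UNIV "(cmod c)\<^sup>2"]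
  by (simp add: ell2_def norm_mult power_mult_distrib)

lemma ell2_diff:
  assumes "f \<in> ell2" "g \<in> ell2"
  shows "(\<lambda>v. f v - g v) \<in> ell2"
  using ell2_add[OF assms(1) ell2_scale[OF assms(2), of "-1"]] by simp

lemma delta_ell2: "delta u \<in> ell2"
proof -
  have "(\<lambda>v. (cmod (delta u v))\<^sup>2) summable_on {u}" by simp
  also have "?this \<longleftrightarrow> (\<lambda>v. (cmod (delta u v))\<^sup>2) summable_on UNIV"
    by (rule summable_on_cong_neutral) (auto simp: delta_def)
  finally show ?thesis by (simp add: ell2_def)
qed

text \<open>Every vertex belongs to at most \<open>K\<close> edges. These bounds on sums over edges make the
  adjacency operator map \<open>ell2\<close> to itself and its quadratic form converge absolutely.\<close>

lemma summable_on_edges: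
  fixes h :: "'a \<Rightarrow> real"
  assumes "symp R" "bounded_degree R" "h summable_on UNIV" "\<And>x. 0 \<le> h x"
  shows "(\<lambda>(x, y). h x) summable_on (SIGMA x:UNIV. {y. R x y})"
    and "(\<lambda>(x, y). h y) summable_on (SIGMA x:UNIV. {y. R x y})"
proof -
  obtain K where K: "\<And>x. finite {y. R x y}" "\<And>x. card {y. R x y} \<le> K"
    using assms(2) by (auto simp: bounded_degree_def)
  show 1: "(\<lambda>(x, y). h x) summable_on (SIGMA x:UNIV. {y. R x y})"
  proof (rule summable_on_SigmaI)
    show "((\<lambda>y. (case (x, y) of (x, y) \<Rightarrow> h x)) has_sum (of_nat (card {y. R x y}) * h x)) {y. R x y}" for x
      using has_sum_finite[OF K(1), of "\<lambda>_. h x" x] by simp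
    show "(\<lambda>x. of_nat (card {y. R x y}) * h x) summable_on UNIV"
    proof (rule summable_on_comparison_test)
      show "(\<lambda>x. real K * h x) summable_on UNIV" by (intro summable_on_cmult_right assms)
    qed (use K assms in \<open>auto intro!: mult_right_mono\<close>)
  qed (use assms in auto)
  have "(\<lambda>(x, y). h y) summable_on (SIGMA x:UNIV. {y. R x y}) \<longleftrightarrow>
        (\<lambda>(x, y). h x) summable_on (SIGMA x:UNIV. {y. R x y})"
    by (rule summable_on_reindex_bij_witness[of _ prod.swap prod.swap])
       (use assms(1) in \<open>auto simp: symp_def\<close>)
  with 1 show "(\<lambda>(x, y). h y) summable_on (SIGMA x:UNIV. {y. R x y})" by simp
qed

lemma adjacency_ell2:
  assumes "symp R" "bounded_degree R" "\<psi> \<in> ell2"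
  shows "(\<lambda>x. \<Sum>y | R x y. \<psi> y) \<in> ell2"
proof -
  obtain K where K: "\<And>x. finite {y. R x y}" "\<And>x. card {y. R x y} \<le> K"
    using assms(2) by (auto simp: bounded_degree_def)
  let ?h = "\<lambda>x. (cmod (\<psi> x))\<^sup>2"
  have "(\<lambda>(x, y). ?h y) summable_on (SIGMA x:UNIV. {y. R x y})"
    by (rule summable_on_edges) (use assms in \<open>auto simp: ell2_def\<close>)
  then have "(\<lambda>x. infsum ?h {y. R x y}) summable_on UNIV"
    by (rule summable_on_Sigma_banach)
  then have *: "(\<lambda>x. \<Sum>y | R x y. ?h y) summable_on UNIV" using K by simp
  show ?thesis
    unfolding ell2_def mem_Collect_eq
  proof (rule summable_on_comparison_test)
    show "(\<lambda>x. real K * (\<Sum>y | R x y. ?h y)) summable_on UNIV"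
      by (intro summable_on_cmult_right *)
    show "(cmod (\<Sum>y | R x y. \<psi> y))\<^sup>2 \<le> real K * (\<Sum>y | R x y. ?h y)" for x
    proof -
      have "(cmod (\<Sum>y | R x y. \<psi> y))\<^sup>2 \<le> (\<Sum>y | R x y. cmod (\<psi> y))\<^sup>2"
        by (intro power_mono norm_sum) auto
      also have "\<dots> \<le> (\<Sum>y | R x y. ?h y) * real (card {y. R x y})"
        by (metis sum_squared_le_sum_of_squares K(1))
      also have "\<dots> \<le> (\<Sum>y | R x y. ?h y) * real K"
        using K by (intro mult_left_mono sum_nonneg) auto
      finally show ?thesis by (simp add: mult.commute)
    qed
  qed auto
qed

section \<open>Uniqueness for the resolvent equation\<close>

text \<open>The quadratic form \<open>\<Sum> cnj (\<psi> x) * \<psi> y\<close> over all edges converges absolutely, and exchanging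
  the end points shows that it is real. The equation evaluates it as
  \<open>\<Sum> (\<gamma> - V x) * \<bar>\<psi> x\<bar>\<^sup>2\<close>, whose imaginary part is \<open>Im \<gamma>\<close> times the squared norm of \<open>\<psi>\<close>.\<close>

lemma schroedinger_eigenfunction_zero:
  assumes "symp R" "bounded_degree R" "Im \<gamma> \<noteq> 0" "\<psi> \<in> ell2"
    and eq: "\<And>x. schroedinger R V \<psi> x = \<gamma> * \<psi> x"
  shows "\<psi> x = 0"
proof -
  let ?E = "SIGMA x:UNIV. {y. R x y}"
  let ?g = "\<lambda>(x, y). cnj (\<psi> x) * \<psi> y"
  have fin: "finite {y. R x y}" for x
    using assms(2) by (auto simp: bounded_degree_def)
  define Z where "Z = infsum ?g ?E"
  have "(\<lambda>z. (\<lambda>(x, y). (cmod (\<psi> x))\<^sup>2) z + (\<lambda>(x, y). (cmod (\<psi> y))\<^sup>2) z) summable_on ?E"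
    by (intro summable_on_add summable_on_edges) (use assms in \<open>auto simp: ell2_def\<close>)
  then have "(\<lambda>z. norm (?g z)) summable_on ?E"
  proof (rule summable_on_comparison_test)
    show "norm (?g z) \<le> (\<lambda>(x, y). (cmod (\<psi> x))\<^sup>2) z + (\<lambda>(x, y). (cmod (\<psi> y))\<^sup>2) z" for z
      using sum_squares_bound[of "cmod (\<psi> (fst z))" "cmod (\<psi> (snd z))"]
        mult_nonneg_nonneg[OF norm_ge_zero norm_ge_zero, of "\<psi> (fst z)" "\<psi> (snd z)"]
      by (auto simp: norm_mult split: prod.splits simp del: mult_nonneg_nonneg norm_ge_zero)
  qed auto
  then have summ: "?g summable_on ?E" by (rule abs_summable_summable)
  have "cnj Z = infsum (\<lambda>z. cnj (?g z)) ?E" by (simp add: Z_def)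
  also have "\<dots> = Z" unfolding Z_def
    by (rule infsum_reindex_bij_witness[of _ prod.swap prod.swap])
       (use assms(1) in \<open>auto simp: symp_def\<close>)
  finally have ImZ: "Im Z = 0" by (simp add: complex_eq_iff)
  have inner: "infsum (\<lambda>y. ?g (x, y)) {y. R x y} = (\<gamma> - of_real (V x)) * of_real ((cmod (\<psi> x))\<^sup>2)" for x
  proof -
    have "infsum (\<lambda>y. ?g (x, y)) {y. R x y} = cnj (\<psi> x) * (\<Sum>y | R x y. \<psi> y)"
      using fin by (simp add: sum_distrib_left)
    also have "(\<Sum>y | R x y. \<psi> y) = (\<gamma> - of_real (V x)) * \<psi> x"
      using eq[of x] by (simp add: schroedinger_def algebra_simps)
    finally show ?thesis by (simp add: complex_norm_square mult_ac del: of_real_power)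
  qed
  have "Z = (\<Sum>\<^sub>\<infinity>x. infsum (\<lambda>y. ?g (x, y)) {y. R x y})"
    unfolding Z_def using infsum_Sigma'_banach[of "\<lambda>x y. ?g (x, y)" UNIV "\<lambda>x. {y. R x y}"] summ by simp
  moreover have "(\<lambda>x. infsum (\<lambda>y. ?g (x, y)) {y. R x y}) summable_on UNIV"
    using summable_on_Sigma_banach[of "\<lambda>x y. ?g (x, y)" UNIV "\<lambda>x. {y. R x y}"] summ by simp
  ultimately have "((\<lambda>x. (\<gamma> - of_real (V x)) * of_real ((cmod (\<psi> x))\<^sup>2)) has_sum Z) UNIV"
    unfolding inner by (simp add: has_sum_infsum)
  then have "((\<lambda>x. Im ((\<gamma> - of_real (V x)) * of_real ((cmod (\<psi> x))\<^sup>2))) has_sum Im Z) UNIV"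
    by (rule has_sum_Im)
  then have "((\<lambda>x. Im \<gamma> * (cmod (\<psi> x))\<^sup>2) has_sum 0) UNIV"
    by (simp add: ImZ)
  from has_sum_cmult_right[OF this, of "inverse (Im \<gamma>)"]
  have "((\<lambda>x. (cmod (\<psi> x))\<^sup>2) has_sum 0) UNIV" using assms(3) by (simp add: field_simps)
  then have "(cmod (\<psi> x))\<^sup>2 = 0"
    by (rule nonneg_has_sum_le_0D) auto
  then show ?thesis by simp
qed

lemma schroedinger_equation_unique:
  assumes "symp R" "bounded_degree R" "Im \<gamma> \<noteq> 0" "\<phi> \<in> ell2" "\<psi> \<in> ell2"
    and eq: "\<And>x. schroedinger R V \<phi> x - \<gamma> * \<phi> x = schroedinger R V \<psi> x - \<gamma> * \<psi> x"
  shows "\<phi> = \<psi>"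
proof
  fix x
  have "(\<lambda>x. \<phi> x - \<psi> x) x = 0"
  proof (rule schroedinger_eigenfunction_zero[of R \<gamma> _ V])
    show "schroedinger R V (\<lambda>x. \<phi> x - \<psi> x) x = \<gamma> * (\<phi> x - \<psi> x)" for x
      using eq[of x] by (simp add: schroedinger_def sum_subtractf algebra_simps)
  qed (use assms in \<open>auto intro: ell2_diff\<close>)
  then show "\<phi> x = \<psi> x" by simp
qed

section \<open>Existence for the resolvent equation\<close>

text \<open>Pairing the equation with \<open>\<psi>\<close> and taking imaginary parts removes the real quadratic form
  of \<open>h\<close>.\<close>

lemma hermitian_energy:
  fixes h :: "'a \<Rightarrow> 'a \<Rightarrow> complex"
  assumes herm: "\<And>x y. h x y = cnj (h y x)"
    and eq: "\<And>x. x \<in> F \<Longrightarrow> (\<Sum>y\<in>F. h x y * \<psi> y) - \<gamma> * \<psi> x = f x"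
  shows "Im \<gamma> * (\<Sum>x\<in>F. (cmod (\<psi> x))\<^sup>2) = - Im (\<Sum>x\<in>F. cnj (\<psi> x) * f x)"
proof -
  define Q where "Q = (\<Sum>x\<in>F. \<Sum>y\<in>F. cnj (\<psi> x) * h x y * \<psi> y)"
  have "cnj Q = (\<Sum>x\<in>F. \<Sum>y\<in>F. cnj (\<psi> y) * h y x * \<psi> x)"
    unfolding Q_def cnj_sum by (intro sum.cong refl) (simp add: mult_ac flip: herm)
  also have "\<dots> = Q" unfolding Q_def by (rule sum.swap)
  finally have "Im Q = 0" by (simp add: complex_eq_iff)
  moreover have "(\<Sum>x\<in>F. cnj (\<psi> x) * f x) = Q - \<gamma> * of_real (\<Sum>x\<in>F. (cmod (\<psi> x))\<^sup>2)"
  proof -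
    have "(\<Sum>x\<in>F. cnj (\<psi> x) * f x) =
        (\<Sum>x\<in>F. (\<Sum>y\<in>F. cnj (\<psi> x) * h x y * \<psi> y) - \<gamma> * of_real ((cmod (\<psi> x))\<^sup>2))"
      by (intro sum.cong refl)
         (simp add: eq[symmetric] sum_distrib_left algebra_simps complex_norm_square del: of_real_power)
    then show ?thesis by (simp add: Q_def sum_subtractf sum_distrib_left del: of_real_power)
  qed
  ultimately show ?thesis by simp
qed

text \<open>Induction on \<open>F\<close> by elimination of a vertex. When \<open>a\<close> is added to \<open>F\<close>, the equations on \<open>F\<close>
  are solved by \<open>\<phi>\<close> with source \<open>f\<close>, and also by a vector \<open>\<kappa>\<close> with source \<open>0\<close> and \<open>\<kappa> a = 1\<close>. A
  multiple of \<open>\<kappa>\<close> added to \<open>\<phi>\<close> adjusts the equation at \<open>a\<close>, unless \<open>\<kappa>\<close> solves the homogeneous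
  equation there too, which the energy identity excludes.\<close>

lemma hermitian_finite_solvable:
  fixes h :: "'a \<Rightarrow> 'a \<Rightarrow> complex"
  assumes herm: "\<And>x y. h x y = cnj (h y x)" and "Im \<gamma> \<noteq> 0" and "finite F"
  shows "\<exists>\<psi>. (\<forall>x. x \<notin> F \<longrightarrow> \<psi> x = 0) \<and> (\<forall>x\<in>F. (\<Sum>y\<in>F. h x y * \<psi> y) - \<gamma> * \<psi> x = f x)"
  using \<open>finite F\<close>
proof (induction F arbitrary: f)
  case empty
  show ?case by (rule exI[of _ "\<lambda>_. 0"]) simp
next
  case (insert a F)
  obtain \<beta> where \<beta>: "\<And>x. x \<notin> F \<Longrightarrow> \<beta> x = 0"
    "\<And>x. x \<in> F \<Longrightarrow> (\<Sum>y\<in>F. h x y * \<beta> y) - \<gamma> * \<beta> x = - h x a"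
    using insert.IH[of "\<lambda>x. - h x a"] by blast
  obtain \<phi> where \<phi>: "\<And>x. x \<notin> F \<Longrightarrow> \<phi> x = 0"
    "\<And>x. x \<in> F \<Longrightarrow> (\<Sum>y\<in>F. h x y * \<phi> y) - \<gamma> * \<phi> x = f x"
    using insert.IH[of f] by blast
  define L where "L = (\<lambda>\<psi> x. (\<Sum>y\<in>insert a F. h x y * \<psi> y) - \<gamma> * \<psi> x)"
  have L: "L (\<lambda>y. \<psi> y + t * \<kappa> y) x = L \<psi> x + t * L \<kappa> x" for \<psi> \<kappa> t x
    by (simp add: L_def sum.distrib sum_distrib_left algebra_simps del: sum.insert)
  define \<kappa> where "\<kappa> = \<beta>(a := 1)"
  have sumF: "(\<Sum>y\<in>F. h x y * \<kappa> y) = (\<Sum>y\<in>F. h x y * \<beta> y)" for x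
    by (rule sum.cong) (use insert.hyps in \<open>auto simp: \<kappa>_def\<close>)
  have \<kappa>F: "L \<kappa> x = 0" if "x \<in> F" for x
  proof -
    have "\<kappa> a = 1" "\<kappa> x = \<beta> x" using that insert.hyps by (auto simp: \<kappa>_def)
    moreover have "(\<Sum>y\<in>F. h x y * \<beta> y) = \<gamma> * \<beta> x - h x a"
      using \<beta>(2)[OF that] by (simp add: diff_eq_eq)
    ultimately show ?thesis using insert.hyps by (simp add: L_def sumF)
  qed
  have \<phi>F: "L \<phi> x = f x" if "x \<in> F" for x
    using that insert.hyps \<phi> by (simp add: L_def)
  have "L \<kappa> a \<noteq> 0"
  proof
    assume "L \<kappa> a = 0"
    with \<kappa>F have "\<And>x. x \<in> insert a F \<Longrightarrow> L \<kappa> x = 0" by auto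
    from hermitian_energy[of h "insert a F" \<kappa> \<gamma> "\<lambda>_. 0", OF herm] this
    have "Im \<gamma> * (\<Sum>x\<in>insert a F. (cmod (\<kappa> x))\<^sup>2) = 0" by (simp add: L_def)
    then have "(\<Sum>x\<in>insert a F. (cmod (\<kappa> x))\<^sup>2) = 0" using assms(2) by simp
    then have "\<kappa> a = 0" using insert.hyps by (subst (asm) sum_nonneg_eq_0_iff) auto
    then show False by (simp add: \<kappa>_def)
  qed
  define t where "t = (f a - L \<phi> a) / L \<kappa> a"
  define \<psi> where "\<psi> = (\<lambda>y. \<phi> y + t * \<kappa> y)"
  have "L \<psi> x = f x" if "x \<in> insert a F" for x
    using that \<kappa>F \<phi>F \<open>L \<kappa> a \<noteq> 0\<close> unfolding \<psi>_def L by (auto simp: t_def)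
  moreover have "\<psi> x = 0" if "x \<notin> insert a F" for x
    using that \<phi>(1) \<beta>(1) by (auto simp: \<psi>_def \<kappa>_def)
  ultimately show ?case by (intro exI[of _ \<psi>]) (simp add: L_def del: sum.insert)
qed

text \<open>The energy identity bounds \<open>\<bar>Im \<gamma>\<bar> \<parallel>\<psi>\<parallel>\<^sup>2\<close> by \<open>\<parallel>\<psi>\<parallel> \<parallel>f\<parallel>\<close>. The bound on \<open>\<psi>\<close> depends neither on
  \<open>h\<close> nor on the size of \<open>F\<close>, which is what passing to an infinite vertex set needs.\<close>

lemma hermitian_finite_bound:
  fixes h :: "'a \<Rightarrow> 'a \<Rightarrow> complex"
  assumes herm: "\<And>x y. h x y = cnj (h y x)" and "Im \<gamma> \<noteq> 0"
    and eq: "\<And>x. x \<in> F \<Longrightarrow> (\<Sum>y\<in>F. h x y * \<psi> y) - \<gamma> * \<psi> x = f x"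
  shows "(\<Sum>x\<in>F. (cmod (\<psi> x))\<^sup>2) \<le> (\<Sum>x\<in>F. (cmod (f x))\<^sup>2) / (Im \<gamma>)\<^sup>2"
proof -
  define n where "n = \<bar>Im \<gamma>\<bar>"
  have n: "n > 0" using assms(2) by (simp add: n_def)
  let ?S = "\<Sum>x\<in>F. (cmod (\<psi> x))\<^sup>2" and ?T = "\<Sum>x\<in>F. (cmod (f x))\<^sup>2"
  have "n * ?S = \<bar>Im \<gamma> * ?S\<bar>" by (simp add: n_def abs_mult sum_nonneg)
  also have "\<dots> = \<bar>Im (\<Sum>x\<in>F. cnj (\<psi> x) * f x)\<bar>"
    using hermitian_energy[of h F \<psi> \<gamma> f, OF herm eq] by simp
  also have "\<dots> \<le> cmod (\<Sum>x\<in>F. cnj (\<psi> x) * f x)" by (rule abs_Im_le_cmod)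
  also have "\<dots> \<le> (\<Sum>x\<in>F. cmod (\<psi> x) * cmod (f x))"
    by (rule order_trans[OF norm_sum]) (simp add: norm_mult)
  finally have "2 * n * (n * ?S) \<le> 2 * n * (\<Sum>x\<in>F. cmod (\<psi> x) * cmod (f x))"
    using n by (intro mult_left_mono) auto
  also have "\<dots> = (\<Sum>x\<in>F. 2 * (n * cmod (\<psi> x)) * cmod (f x))"
    by (simp add: sum_distrib_left mult_ac)
  also have "\<dots> \<le> (\<Sum>x\<in>F. (n * cmod (\<psi> x))\<^sup>2 + (cmod (f x))\<^sup>2)"
    by (intro sum_mono sum_squares_bound)
  also have "\<dots> = n\<^sup>2 * ?S + ?T" by (simp add: sum.distrib power_mult_distrib sum_distrib_left)
  finally have "n\<^sup>2 * ?S \<le> ?T" by (simp add: power2_eq_square)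
  then show ?thesis using n by (simp add: n_def field_simps)
qed

lemma compact_PiE_cball: "compact (\<Pi>\<^sub>E x\<in>UNIV. cball (0::complex) r)"
proof -
  have "compactin (product_topology (\<lambda>_. euclidean) UNIV) (\<Pi>\<^sub>E x\<in>UNIV. cball (0::complex) r)"
    by (simp add: compactin_PiE)
  then show ?thesis by (simp add: euclidean_product_topology)
qed

text \<open>For finite \<open>F\<close> let \<open>C F\<close> consist of the functions that solve the equation at the vertices
  of \<open>F\<close> and obey the uniform norm bound there. As the equation at a vertex involves only
  its finitely many neighbours, \<open>C F\<close> is closed under pointwise convergence, and it contains the
  solution of the equation restricted to \<open>F\<close> and its neighbours. The sets \<open>C F\<close> decrease as \<open>F\<close>
  grows, so by compactness of the product of discs they have a common element.\<close>

lemma schroedinger_equation_solvable: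
  assumes "symp R" and deg: "bounded_degree R" and \<gamma>: "Im \<gamma> \<noteq> 0" and f: "f \<in> ell2"
  shows "\<exists>\<psi>\<in>ell2. \<forall>x. schroedinger R V \<psi> x - \<gamma> * \<psi> x = f x"
proof -
  let ?h = "schroedinger_kernel R V"
  have fin: "finite {y. R x y}" for x
    using deg by (auto simp: bounded_degree_def)
  have herm: "?h x y = cnj (?h y x)" for x y
    using \<open>symp R\<close> by (auto simp: schroedinger_kernel_eq[OF deg] symp_def)
  define B where "B = (\<Sum>\<^sub>\<infinity>x. (cmod (f x))\<^sup>2) / (Im \<gamma>)\<^sup>2"
  have sumf: "(\<Sum>x\<in>F. (cmod (f x))\<^sup>2) / (Im \<gamma>)\<^sup>2 \<le> B" if "finite F" for F
    unfolding B_def using f that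
    by (intro divide_right_mono finite_sum_le_infsum) (auto simp: ell2_def)
  define C where "C = (\<lambda>F. {\<psi>. (\<forall>x\<in>F. schroedinger R V \<psi> x - \<gamma> * \<psi> x = f x) \<and>
                              (\<Sum>x\<in>F. (cmod (\<psi> x))\<^sup>2) \<le> B})"
  have closed: "closed (C F)" for F
  proof -
    have coord: "continuous_on UNIV (\<lambda>\<psi>::'a \<Rightarrow> complex. \<psi> x)" for x
      by (rule continuous_on_product_coordinates)
    have "C F = (\<Inter>x\<in>F. {\<psi>. schroedinger R V \<psi> x - \<gamma> * \<psi> x = f x}) \<inter>
                {\<psi>. (\<Sum>x\<in>F. (cmod (\<psi> x))\<^sup>2) \<le> B}"
      by (auto simp: C_def)
    also have "closed \<dots>" unfolding schroedinger_def
      by (intro closed_Int closed_INT ballI closed_Collect_eq closed_Collect_le)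
         (intro continuous_intros coord)+
    finally show ?thesis .
  qed
  have nonempty: "(\<Pi>\<^sub>E x\<in>UNIV. cball 0 (sqrt B)) \<inter> C F \<noteq> {}" if "finite F" for F
  proof -
    define F' where "F' = F \<union> (\<Union>x\<in>F. {y. R x y})"
    have F': "finite F'" using that fin by (auto simp: F'_def)
    obtain \<psi> where \<psi>: "\<And>x. x \<notin> F' \<Longrightarrow> \<psi> x = 0"
      "\<And>x. x \<in> F' \<Longrightarrow> (\<Sum>y\<in>F'. ?h x y * \<psi> y) - \<gamma> * \<psi> x = f x"
      using hermitian_finite_solvable[of ?h \<gamma> F' f, OF herm \<gamma> F'] by blast
    have bound: "(\<Sum>x\<in>F'. (cmod (\<psi> x))\<^sup>2) \<le> B"
      using hermitian_finite_bound[of ?h \<gamma> F' \<psi> f, OF herm \<gamma> \<psi>(2)] sumf[OF F'] by linarith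
    have "schroedinger R V \<psi> x - \<gamma> * \<psi> x = f x" if "x \<in> F" for x
    proof -
      have "(\<Sum>y\<in>F'. ?h x y * \<psi> y) =
          (\<Sum>y\<in>F'. if R x y then \<psi> y else 0) + (\<Sum>y\<in>F'. if x = y then of_real (V x) * \<psi> y else 0)"
        unfolding schroedinger_kernel_eq[OF deg] sum.distrib[symmetric]
        by (intro sum.cong) (auto simp: algebra_simps)
      also have "(\<Sum>y\<in>F'. if x = y then of_real (V x) * \<psi> y else 0) = of_real (V x) * \<psi> x"
        using F' that by (simp add: F'_def)
      also have "(\<Sum>y\<in>F'. if R x y then \<psi> y else 0) = (\<Sum>y | R x y. \<psi> y)"
        using F' that by (intro sum.mono_neutral_cong_right) (auto simp: F'_def)
      finally show ?thesis using \<psi>(2)[of x] that by (simp add: schroedinger_def F'_def)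
    qed
    moreover have "(\<Sum>x\<in>F. (cmod (\<psi> x))\<^sup>2) \<le> B"
      by (rule order_trans[OF sum_mono2 bound]) (use F' in \<open>auto simp: F'_def\<close>)
    moreover have "cmod (\<psi> x) \<le> sqrt B" for x
    proof (cases "x \<in> F'")
      case True
      then have "(cmod (\<psi> x))\<^sup>2 \<le> B"
        using member_le_sum[of x F' "\<lambda>x. (cmod (\<psi> x))\<^sup>2"] F' bound by simp
      then show ?thesis by (rule real_le_rsqrt)
    next
      case False
      then show ?thesis using sumf[of "{}"] by (simp add: \<psi>(1))
    qed
    ultimately have "\<psi> \<in> (\<Pi>\<^sub>E x\<in>UNIV. cball 0 (sqrt B)) \<inter> C F"
      by (auto simp: C_def)
    then show ?thesis by blast
  qed
  have "(\<Pi>\<^sub>E x\<in>UNIV. cball 0 (sqrt B)) \<inter> \<Inter> (C ` Collect finite) \<noteq> {}"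
  proof (rule compact_imp_fip[OF compact_PiE_cball])
    fix \<F> assume "finite \<F>" "\<F> \<subseteq> C ` Collect finite"
    then obtain \<G> where \<G>: "finite \<G>" "\<G> \<subseteq> Collect finite" "\<F> = C ` \<G>"
      by (meson finite_subset_image)
    have "C (\<Union>\<G>) \<subseteq> C F" if "F \<in> \<G>" for F
    proof
      fix \<psi> assume "\<psi> \<in> C (\<Union>\<G>)"
      moreover have "(\<Sum>x\<in>F. (cmod (\<psi> x))\<^sup>2) \<le> (\<Sum>x\<in>\<Union>\<G>. (cmod (\<psi> x))\<^sup>2)"
        using that \<G> by (intro sum_mono2) auto
      ultimately show "\<psi> \<in> C F" using that by (auto simp: C_def)
    qed
    moreover have "(\<Pi>\<^sub>E x\<in>UNIV. cball 0 (sqrt B)) \<inter> C (\<Union>\<G>) \<noteq> {}"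
      using \<G> by (intro nonempty) auto
    ultimately show "(\<Pi>\<^sub>E x\<in>UNIV. cball 0 (sqrt B)) \<inter> \<Inter> \<F> \<noteq> {}" using \<G>(3) by blast
  qed (use closed in auto)
  then obtain \<psi> where \<psi>: "\<And>F. finite F \<Longrightarrow> \<psi> \<in> C F" by blast
  have "schroedinger R V \<psi> x - \<gamma> * \<psi> x = f x" for x
    using \<psi>[of "{x}"] by (simp add: C_def)
  moreover have "\<psi> \<in> ell2" unfolding ell2_def mem_Collect_eq
    by (rule nonneg_bdd_above_summable_on)
       (use \<psi> in \<open>auto simp: C_def intro!: bdd_aboveI[of _ B]\<close>)
  ultimately show ?thesis by blast
qed

text \<open>In the equation every term but \<open>V \<psi>\<close> is known to be in \<open>ell2\<close>, so \<open>V \<psi>\<close> is as well: solutions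
  in \<open>ell2\<close> are automatically in the domain.\<close>

lemma schroedinger_domI:
  assumes "symp R" "bounded_degree R" "\<psi> \<in> ell2" "f \<in> ell2"
    and eq: "\<And>x. schroedinger R V \<psi> x - \<gamma> * \<psi> x = f x"
  shows "\<psi> \<in> schroedinger_dom V"
proof -
  have "(\<lambda>x. (f x + \<gamma> * \<psi> x) - (\<Sum>y | R x y. \<psi> y)) \<in> ell2"
    by (intro ell2_diff ell2_add ell2_scale adjacency_ell2 assms)
  also have "(\<lambda>x. (f x + \<gamma> * \<psi> x) - (\<Sum>y | R x y. \<psi> y)) = (\<lambda>x. of_real (V x) * \<psi> x)"
    using eq by (auto simp: schroedinger_def algebra_simps)
  finally show ?thesis using assms by (simp add: schroedinger_dom_def)
qed

lemma resolvent_equation: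
  fixes V :: "'a \<Rightarrow> real"
  assumes "symp R" "bounded_degree R" "Im \<gamma> \<noteq> 0" "f \<in> ell2"
  defines "\<psi> \<equiv> resolvent (schroedinger_dom V) (schroedinger R V) \<gamma> f"
  shows "\<psi> \<in> ell2" "schroedinger R V \<psi> x - \<gamma> * \<psi> x = f x"
proof -
  obtain \<phi> where \<phi>: "\<phi> \<in> ell2" "\<And>x. schroedinger R V \<phi> x - \<gamma> * \<phi> x = f x"
    using schroedinger_equation_solvable[OF assms(1-4)] by blast
  then have "\<phi> \<in> schroedinger_dom V" by (intro schroedinger_domI[OF assms(1,2) _ assms(4)])
  moreover have "(\<lambda>x. schroedinger R V \<phi> x - \<gamma> * \<phi> x) = f" using \<phi> by auto
  ultimately have im: "f \<in> (\<lambda>\<psi> x. schroedinger R V \<psi> x - \<gamma> * \<psi> x) ` schroedinger_dom V"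
    by blast
  from inv_into_into[OF im] show "\<psi> \<in> ell2"
    by (simp add: \<psi>_def resolvent_def schroedinger_dom_def)
  from f_inv_into_f[OF im] show "schroedinger R V \<psi> x - \<gamma> * \<psi> x = f x"
    unfolding \<psi>_def resolvent_def by (rule fun_cong)
qed

section \<open>The operator on a cut tree\<close>

text \<open>On all of \<open>ell2\<close> the operator on the cut tree is itself a Schroedinger operator: the
  vertices off the cut tree become isolated and have zero potential. The results on
  \<open>schroedinger R V\<close> then apply to it.\<close>

definition cut_adj :: "('a \<Rightarrow> 'a \<Rightarrow> bool) \<Rightarrow> 'a \<Rightarrow> 'a \<Rightarrow> 'a \<Rightarrow> 'a \<Rightarrow> bool" where
  "cut_adj adj v w x y \<longleftrightarrow> adj x y \<and> x \<in> cut_tree adj v w \<and> y \<in> cut_tree adj v w"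

definition cut_potential ::
    "('a \<Rightarrow> 'a \<Rightarrow> bool) \<Rightarrow> ('a \<Rightarrow> real) \<Rightarrow> 'a \<Rightarrow> 'a \<Rightarrow> 'a \<Rightarrow> real" where
  "cut_potential adj V v w x = (if x \<in> cut_tree adj v w then V x else 0)"

lemma symp_cut_adj: "symp adj \<Longrightarrow> symp (cut_adj adj v w)"
  by (auto simp: symp_def cut_adj_def)

lemma bounded_degree_cut_adj:
  assumes "bounded_degree adj"
  shows "bounded_degree (cut_adj adj v w)"
proof -
  obtain K where K: "\<And>x. finite {y. adj x y}" "\<And>x. card {y. adj x y} \<le> K"
    using assms by (auto simp: bounded_degree_def)
  have sub: "{y. cut_adj adj v w x y} \<subseteq> {y. adj x y}" for x by (auto simp: cut_adj_def)
  have "finite {y. cut_adj adj v w x y} \<and> card {y. cut_adj adj v w x y} \<le> K" for x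
    using finite_subset[OF sub K(1)] card_mono[OF K(1) sub] K(2) order_trans by blast
  then show ?thesis by (auto simp: bounded_degree_def)
qed

lemma cut_schroedinger_eq:
  assumes "bounded_degree adj"
  shows "cut_schroedinger adj V v w = schroedinger (cut_adj adj v w) (cut_potential adj V v w)"
proof (intro ext)
  fix \<psi> :: "'a \<Rightarrow> complex" and x
  let ?A = "cut_adj adj v w" and ?V = "cut_potential adj V v w"
  have fin: "finite {y. ?A x y}"
    using bounded_degree_cut_adj[OF assms] by (auto simp: bounded_degree_def)
  have "cut_schroedinger adj V v w \<psi> x =
      (\<Sum>\<^sub>\<infinity>y. (if ?A x y then \<psi> y else 0) + (if x = y then of_real (?V x) * \<psi> x else 0))"
    unfolding cut_schroedinger_def
    by (intro infsum_cong)
       (auto simp: cut_kernel_def schroedinger_kernel_eq[OF assms] cut_adj_def cut_potential_def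
         algebra_simps)
  also have "\<dots> = (\<Sum>y\<in>insert x {y. ?A x y}.
      (if ?A x y then \<psi> y else 0) + (if x = y then of_real (?V x) * \<psi> x else 0))"
    using fin by (subst infsum_finite[symmetric], simp) (intro infsum_cong_neutral; auto)
  also have "\<dots> = (\<Sum>y | ?A x y. \<psi> y) + of_real (?V x) * \<psi> x"
    unfolding sum.distrib using fin
    by (intro arg_cong2[of _ _ _ _ "(+)"] sum.mono_neutral_cong_right) auto
  finally show "cut_schroedinger adj V v w \<psi> x = schroedinger ?A ?V \<psi> x"
    by (simp add: schroedinger_def)
qed

lemma cut_schroedinger_dom_eq:
  "cut_schroedinger_dom adj V v w = schroedinger_dom (cut_potential adj V v w)"
  unfolding cut_schroedinger_dom_def schroedinger_dom_def cut_potential_def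
  by (intro Collect_cong conj_cong arg_cong[of _ _ "\<lambda>f. f \<in> ell2"]) auto

lemma cut_green_eq:
  assumes "bounded_degree adj"
  shows "cut_green adj V v w x y \<gamma> =
    green (cut_adj adj v w) (cut_potential adj V v w) x y \<gamma>"
  by (simp add: cut_green_def green_def cut_schroedinger_eq[OF assms] cut_schroedinger_dom_eq)

section \<open>Factorization and boundary values of Green functions\<close>

text \<open>The Green function with pole at \<open>v\<close>, restricted to the branch of \<open>u\<close> away from \<open>v\<close>, feels
  the rest of the tree only through its value at \<open>w\<close>, which acts as a source at \<open>u\<close>. It is therefore a
  multiple of the Green function of the branch.\<close>

lemma green_factorization:
  assumes T: "tree adj" and deg: "bounded_degree adj" and \<gamma>: "Im \<gamma> \<noteq> 0"
    and uw: "adj u w" and v: "v \<notin> cut_tree adj u w"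
  shows "green adj V u v \<gamma> = green adj V w v \<gamma> * zeta adj V w \<gamma> u"
proof -
  let ?C = "cut_tree adj u w" and ?A = "cut_adj adj u w" and ?V = "cut_potential adj V u w"
  have sym: "symp adj" using T by (auto simp: tree_def simple_graph_def symp_def)
  note cut = symp_cut_adj[OF sym, of u w] bounded_degree_cut_adj[OF deg, of u w]
  have fin: "finite {y. adj x y}" for x using deg by (auto simp: bounded_degree_def)
  define \<phi> where "\<phi> = resolvent (schroedinger_dom V) (schroedinger adj V) \<gamma> (delta v)"
  define \<rho> where "\<rho> = resolvent (schroedinger_dom ?V) (schroedinger ?A ?V) \<gamma> (delta u)"
  have \<phi>: "\<phi> \<in> ell2" "\<And>x. schroedinger adj V \<phi> x - \<gamma> * \<phi> x = delta v x"
    using resolvent_equation[OF sym deg \<gamma> delta_ell2] by (auto simp: \<phi>_def)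
  have \<rho>: "\<rho> \<in> ell2" "\<And>x. schroedinger ?A ?V \<rho> x - \<gamma> * \<rho> x = delta u x"
    using resolvent_equation[OF cut \<gamma> delta_ell2] by (auto simp: \<rho>_def)
  define \<phi>' where "\<phi>' = (\<lambda>x. if x \<in> ?C then \<phi> x else 0)"
  have "\<phi>' = (\<lambda>x. - \<phi> w * \<rho> x)"
  proof (rule schroedinger_equation_unique[OF cut \<gamma>])
    fix x
    have "schroedinger ?A ?V \<phi>' x - \<gamma> * \<phi>' x = - \<phi> w * delta u x"
    proof (cases "x \<in> ?C")
      case True
      have "(\<Sum>y | adj x y. \<phi> y) = (\<Sum>y | ?A x y. \<phi>' y) + (\<Sum>y | adj x y \<and> y \<notin> ?C. \<phi> y)"
      proof -
        have "{y. adj x y} = {y. ?A x y} \<union> {y. adj x y \<and> y \<notin> ?C}"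
          using True by (auto simp: cut_adj_def)
        then have "(\<Sum>y | adj x y. \<phi> y) = (\<Sum>y\<in>{y. ?A x y} \<union> {y. adj x y \<and> y \<notin> ?C}. \<phi> y)"
          by simp
        also have "\<dots> = (\<Sum>y | ?A x y. \<phi> y) + (\<Sum>y | adj x y \<and> y \<notin> ?C. \<phi> y)"
          by (rule sum.union_disjoint)
             (auto simp: cut_adj_def intro: finite_subset[OF _ fin[of x]])
        also have "(\<Sum>y | ?A x y. \<phi> y) = (\<Sum>y | ?A x y. \<phi>' y)"
          by (rule sum.cong) (auto simp: \<phi>'_def cut_adj_def)
        finally show ?thesis .
      qed
      \<comment> \<open>The restriction loses one neighbour of \<open>u\<close> and none of any other vertex.\<close>
      also have "{y. adj x y \<and> y \<notin> ?C} = (if x = u then {w} else {})"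
        using cut_tree_exit[OF T uw True] cut_tree_root[OF T uw] uw by auto
      finally have lost: "(\<Sum>y | ?A x y. \<phi>' y) = (\<Sum>y | adj x y. \<phi> y) - \<phi> w * delta u x"
        by (auto simp: delta_def)
      have same: "\<phi>' x = \<phi> x" "?V x = V x" using True by (auto simp: \<phi>'_def cut_potential_def)
      have "schroedinger ?A ?V \<phi>' x - \<gamma> * \<phi>' x =
          (schroedinger adj V \<phi> x - \<gamma> * \<phi> x) - \<phi> w * delta u x"
        unfolding schroedinger_def lost same by simp
      also have "schroedinger adj V \<phi> x - \<gamma> * \<phi> x = 0"
        using v True by (auto simp: \<phi>(2) delta_def)
      finally show ?thesis by simp
    next
      case False
      then show ?thesis using cut_tree_root(1)[OF T uw]
        by (auto simp: schroedinger_def cut_adj_def cut_potential_def \<phi>'_def delta_def)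
    qed
    moreover have "schroedinger ?A ?V (\<lambda>x. - \<phi> w * \<rho> x) x - \<gamma> * (- \<phi> w * \<rho> x) =
        - \<phi> w * (schroedinger ?A ?V \<rho> x - \<gamma> * \<rho> x)"
      by (simp add: schroedinger_def sum_distrib_left sum_negf algebra_simps)
    ultimately show "schroedinger ?A ?V \<phi>' x - \<gamma> * \<phi>' x =
        schroedinger ?A ?V (\<lambda>x. - \<phi> w * \<rho> x) x - \<gamma> * (- \<phi> w * \<rho> x)"
      by (simp only: \<rho>(2))
  next
    show "\<phi>' \<in> ell2" by (rule ell2_comparison[OF \<phi>(1)]) (simp add: \<phi>'_def)
    show "(\<lambda>x. - \<phi> w * \<rho> x) \<in> ell2" by (rule ell2_scale[OF \<rho>(1)])
  qed
  then have "\<phi> u = - \<phi> w * \<rho> u"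
    using cut_tree_root(1)[OF T uw] by (auto simp: \<phi>'_def fun_eq_iff split: if_splits)
  then show ?thesis
    by (simp add: zeta_def cut_green_eq[OF deg] green_eq \<phi>_def \<rho>_def)
qed

text \<open>The factors of \<open>G(u, v)\<close> along the arc are finite in number and have nonzero limits.
  That the product has a nonzero limit too allows it to be a denominator.\<close>

lemma green_limit_nonzero:
  assumes T: "tree adj" and deg: "bounded_degree adj"
    and "exceptional_set adj V A" and "E \<in> - A"
  shows "\<exists>L. L \<noteq> 0 \<and>
    ((\<lambda>\<eta>. green adj V u v (of_real E + \<i> * of_real \<eta>)) \<longlongrightarrow> L) (at_right (0::real))"
proof -
  let ?\<gamma> = "\<lambda>\<eta>::real. complex_of_real E + \<i> * of_real \<eta>"
  have diag: "\<exists>L. L \<noteq> 0 \<and> ((\<lambda>\<eta>. green adj V v v (?\<gamma> \<eta>)) \<longlongrightarrow> L) (at_right 0)"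
    and zeta: "adj w u \<Longrightarrow> \<exists>L. L \<noteq> 0 \<and> ((\<lambda>\<eta>. zeta adj V w (?\<gamma> \<eta>) u) \<longlongrightarrow> L) (at_right 0)" for u w
    using assms(3,4) unfolding exceptional_set_def by blast+
  have "\<exists>L. L \<noteq> 0 \<and> ((\<lambda>\<eta>. green adj V (hd p) v (?\<gamma> \<eta>)) \<longlongrightarrow> L) (at_right 0)"
    if "is_arc adj p" "last p = v" for p
    using that
  proof (induction p rule: induct_list012)
    case (3 u w p)
    have "is_arc adj (w # p)" using 3(3) by (rule is_arc_tl)
    with 3 obtain L where L: "L \<noteq> 0" "((\<lambda>\<eta>. green adj V w v (?\<gamma> \<eta>)) \<longlongrightarrow> L) (at_right 0)"
      by auto
    have uw: "adj u w" using 3(3) by (cases p) auto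
    then have "adj w u" using T by (auto simp: tree_def simple_graph_def)
    with zeta obtain M where
      M: "M \<noteq> 0" "((\<lambda>\<eta>. zeta adj V w (?\<gamma> \<eta>) u) \<longlongrightarrow> M) (at_right 0)" by blast
    have "arc_between adj u v = u # w # p"
      using 3(3,4) by (intro arc_between_eqI[OF T]) auto
    then have v: "v \<notin> cut_tree adj u w" by (simp add: cut_tree_def)
    have "\<forall>\<^sub>F \<eta> in at_right 0. green adj V w v (?\<gamma> \<eta>) * zeta adj V w (?\<gamma> \<eta>) u =
        green adj V u v (?\<gamma> \<eta>)"
      using eventually_at_right_less[of 0]
      by eventually_elim (rule green_factorization[OF T deg _ uw v, symmetric], simp)
    then have "((\<lambda>\<eta>. green adj V u v (?\<gamma> \<eta>)) \<longlongrightarrow> L * M) (at_right 0)"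
      by (rule Lim_transform_eventually[OF tendsto_mult[OF L(2) M(2)]])
    then show ?case using L M by (intro exI[of _ "L * M"]) simp
  qed (use diag in auto)
  from this[of "arc_between adj u v"] show ?thesis using arc_between_props[OF T, of u v] by simp
qed

theorem proposition3p5:
  fixes adj :: "'a \<Rightarrow> 'a \<Rightarrow> bool" and V :: "'a \<Rightarrow> real" and orig v :: 'a
    and A :: "real set" and E :: real and \<xi> :: "(nat \<Rightarrow> 'a) set"
  assumes "tree adj" and "bounded_degree adj"
    and "exceptional_set adj V A" and "E \<in> - A"
    and "\<xi> \<in> boundary adj"
  shows "\<exists>P::complex.
    ((\<lambda>\<eta>. poisson adj V orig (of_real E + \<i> * of_real \<eta>) \<xi> v) \<longlongrightarrow> P) (at_right (0::real))"
proof -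
  define m where "m = meet_bdry adj orig v \<xi>"
  obtain L where "((\<lambda>\<eta>. green adj V m v (of_real E + \<i> * of_real \<eta>)) \<longlongrightarrow> L) (at_right (0::real))"
    using green_limit_nonzero[OF assms(1-4)] by blast
  moreover obtain M where "M \<noteq> 0"
    "((\<lambda>\<eta>. green adj V orig m (of_real E + \<i> * of_real \<eta>)) \<longlongrightarrow> M) (at_right (0::real))"
    using green_limit_nonzero[OF assms(1-4)] by blast
  ultimately show ?thesis
    unfolding poisson_def m_def[symmetric] by (intro exI[of _ "L / M"] tendsto_divide)
qed

end
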